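(* Let $N\ge 1$ and $n=\lceil N/3\rceil$, and let $j=e^{2i\pi/3}$. The transfer matrix $\mathbb L_N$ has size $F_{N+1}$. If $N\equiv 1\pmod 3$, then $\mathbb L_N$ is nilpotent. Otherwise, the eigenvalues of $\mathbb L_N$ are: \begin{itemize} \item $0$ with multiplicity $F_{N+1}-2^n$, \item $1$ with multiplicity $(2^n+2(-1)^n)/3$, \item $j$ and $j^2$, each with multiplicity $(2^n-(-1)^n)/3$. \end{itemize}
   Context: The Fibonacci numbers are normalized by $F_0=F_1=1$ and $F_{N+1}=F_N+F_{N-1}$. The square complex matrix $\mathbb L_N$ has rows and columns indexed by the independent sets of the segment (path) with vertices $1,2,\ldots,N$, that is, by the subsets of $\{1,\ldots,N\}$ containing no two consecutive integers. For two such sets $C$ and $D$, $$\mathbb L_N(C,D)=\begin{cases} i^{|C|+|D|}&\text{if } C\cap(D+1)=\emptyset,\\ 0&\text{otherwise,}\end{cases}$$ where $i$ is the imaginary unit and $D+1=\{d+1:d\in D\}$. Multiplicities are algebraic multiplicities (as roots of the characteristic polynomial); multiplicity $0$ means that the number is not an eigenvalue. *)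

theory Defs
  imports Complex_Main "HOL-Number_Theory.Fib" "Jordan_Normal_Form.Char_Poly"
begin

text \<open>The library's \<^const>\<open>fib\<close> has \<open>fib 0 = 0\<close> and \<open>fib 1 = 1\<close>; here the
  normalization is \<open>F\<^sub>0 = F\<^sub>1 = 1\<close>, that is, a shift by one.\<close>

definition F :: "nat \<Rightarrow> nat" where
  "F N = fib (Suc N)"

lemma F_0: "F 0 = 1" and F_1: "F 1 = 1" and F_rec: "N \<ge> 1 \<Longrightarrow> F (N + 1) = F N + F (N - 1)"
  by (cases N; simp add: F_def)+

definition indep_sets :: "nat \<Rightarrow> nat set set" where
  "indep_sets N = {C. C \<subseteq> {1..N} \<and> (\<forall>k. \<not> (k \<in> C \<and> k + 1 \<in> C))}"

definition L_entry :: "nat set \<Rightarrow> nat set \<Rightarrow> complex" where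
  "L_entry C D = (if C \<inter> (\<lambda>d. d + 1) ` D = {} then \<i> ^ (card C + card D) else 0)"

text \<open>Matrices are indexed by natural numbers, so a matrix with rows and columns indexed by a
  finite set is given through an enumeration of that set, the same one for rows and columns.
  Changing the enumeration conjugates the matrix by a permutation matrix.\<close>

definition enumerates :: "'a list \<Rightarrow> 'a set \<Rightarrow> bool" where
  "enumerates cs S \<longleftrightarrow> distinct cs \<and> set cs = S"

definition L_mat :: "nat set list \<Rightarrow> complex mat" where
  "L_mat cs = mat (length cs) (length cs) (\<lambda>(a, b). L_entry (cs ! a) (cs ! b))"

lemma ex_enumerates_indep_sets: "\<exists>cs. enumerates cs (indep_sets N)"
proof -
  have "finite (indep_sets N)"
    by (rule finite_subset[of _ "Pow {1..N}"]) (auto simp: indep_sets_def)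
  then show ?thesis
    using finite_distinct_list unfolding enumerates_def by blast
qed

definition nilpotent_mat :: "'a :: semiring_1 mat \<Rightarrow> bool" where
  "nilpotent_mat A \<longleftrightarrow> (\<exists>k. A ^\<^sub>m k = 0\<^sub>m (dim_row A) (dim_col A))"

definition alg_mult :: "'a :: idom mat \<Rightarrow> 'a \<Rightarrow> nat" where
  "alg_mult A x = order x (char_poly A)"

end

theory Submission
  imports Defs "Jordan_Normal_Form.Schur_Decomposition"
begin

text \<open>The nonzero eigenvalues and their multiplicities are determined by the traces of the powers
  of \<open>L\<^sub>N\<close>: the trace of the \<open>m\<close>-th power is the sum of the \<open>m\<close>-th powers of the eigenvalues,
  and the sequences \<open>m \<mapsto> \<lambda>\<^sup>m\<close> for distinct nonzero \<open>\<lambda>\<close> are linearly independent, even when a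
  few initial terms are dropped (\<open>alg_mult_from_traces\<close>). So everything comes down to these traces.

  They are multiplicative in blocks of three vertices. Suppose that \<open>3 \<in> x\<close> and consider two
  consecutive transitions \<open>x, y, z\<close>. A nonzero entry at \<open>(x, y)\<close> forces \<open>2 \<notin> y\<close>, and \<open>2 \<notin> x\<close>
  because \<open>x\<close> is independent; hence nothing prevents vertex \<open>1\<close> from being added to \<open>y\<close> or
  removed from it. Adding it multiplies each of the two entries by \<open>\<i>\<close>, so the product changes its
  sign, and the sum over \<open>y\<close> vanishes (\<open>toggle_cancel\<close>). The toggle does not touch vertex
  \<open>3\<close>, so the sum vanishes also when only those \<open>y\<close> that contain \<open>3\<close>, or only those that do
  not, are admitted. By linear algebra the sets that contain \<open>3\<close> can then be deleted
  without changing the traces of the powers from the third on (locale \<open>deletable\<close>). This is a transfer matrix form of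
  the folding move for independence complexes: the neighbours of vertex \<open>1\<close> in one row are also
  neighbours of vertex \<open>3\<close> in the preceding row.

  Once vertex \<open>3\<close> is gone, the vertices \<open>1, 2\<close> no longer interact with \<open>4, \<dots>, N\<close>, and the matrix is
  the tensor product of those for the sizes \<open>2\<close> and \<open>N - 3\<close> (locale \<open>tensor_kernel\<close>). For size
  \<open>2\<close> the \<open>m\<close>-th trace is \<open>j\<^sup>m + j\<^sup>2\<^sup>m\<close>, for size \<open>0\<close> it is \<open>1\<close>, and for size \<open>1\<close> the matrix has
  square zero. Thus \<open>L\<^sub>N\<close> is nilpotent if \<open>N \<equiv> 1 (mod 3)\<close>, and otherwise the trace
  is \<open>(w + w\<^sup>2)\<^sup>n\<close> with \<open>w = j\<^sup>m\<close>. As \<open>w + w\<^sup>2\<close> is \<open>2\<close> for \<open>w = 1\<close> and \<open>-1\<close> for the other two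
  cube roots of unity, this power is a combination of \<open>1, w, w\<^sup>2\<close> whose coefficients are
  the multiplicities of \<open>1, j, j\<^sup>2\<close> (\<open>cube_root_power_sum\<close>).\<close>

section \<open>Powers and traces of kernels on finite sets\<close>

text \<open>A kernel is a square matrix whose rows and columns are indexed by the elements of a set
  instead of by numbers. Restricting the index set and forming tensor products then need no
  choice of an enumeration.\<close>

primrec kernel_pow :: "'a set \<Rightarrow> ('a \<Rightarrow> 'a \<Rightarrow> 'b::comm_ring_1) \<Rightarrow> nat \<Rightarrow> 'a \<Rightarrow> 'a \<Rightarrow> 'b" where
  "kernel_pow S K 0 = (\<lambda>x y. if x = y then 1 else 0)"
| "kernel_pow S K (Suc m) = (\<lambda>x y. \<Sum>z\<in>S. K x z * kernel_pow S K m z y)"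

definition kernel_trace :: "'a set \<Rightarrow> ('a \<Rightarrow> 'a \<Rightarrow> 'b::comm_ring_1) \<Rightarrow> 'b" where
  "kernel_trace S K = (\<Sum>x\<in>S. K x x)"

lemma kernel_pow_1:
  assumes "finite S" "y \<in> S"
  shows "kernel_pow S K (Suc 0) x y = K x y"
proof -
  have "kernel_pow S K (Suc 0) x y = (\<Sum>z\<in>S. if z = y then K x z else 0)"
    by (auto intro!: sum.cong)
  then show ?thesis using assms by simp
qed

lemma kernel_pow_2:
  assumes "finite S" "y \<in> S"
  shows "kernel_pow S K (Suc (Suc 0)) x y = (\<Sum>z\<in>S. K x z * K z y)"
  unfolding kernel_pow.simps(2)[of S K "Suc 0"] by (simp only: kernel_pow_1[OF assms])

lemma kernel_pow_add:
  assumes "finite S" "x \<in> S"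
  shows "kernel_pow S K (m + k) x y = (\<Sum>z\<in>S. kernel_pow S K m x z * kernel_pow S K k z y)"
  using assms(2)
proof (induction m arbitrary: x)
  case 0
  have "(\<Sum>z\<in>S. kernel_pow S K 0 x z * kernel_pow S K k z y)
      = (\<Sum>z\<in>S. if x = z then kernel_pow S K k z y else 0)"
    by (auto intro!: sum.cong)
  then show ?case using assms(1) 0 by simp
next
  case (Suc m)
  have "kernel_pow S K (Suc m + k) x y
      = (\<Sum>w\<in>S. K x w * (\<Sum>z\<in>S. kernel_pow S K m w z * kernel_pow S K k z y))"
    using Suc.IH by (simp cong: sum.cong)
  also have "\<dots> = (\<Sum>w\<in>S. \<Sum>z\<in>S. K x w * kernel_pow S K m w z * kernel_pow S K k z y)"
    by (simp add: sum_distrib_left mult.assoc)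
  also have "\<dots> = (\<Sum>z\<in>S. kernel_pow S K (Suc m) x z * kernel_pow S K k z y)"
    by (subst sum.swap) (simp add: sum_distrib_right)
  finally show ?case .
qed

lemma kernel_pow_two_steps:
  "kernel_pow S K (Suc (Suc m)) x y = (\<Sum>w\<in>S. (\<Sum>z\<in>S. K x z * K z w) * kernel_pow S K m w y)"
proof -
  have "kernel_pow S K (Suc (Suc m)) x y = (\<Sum>z\<in>S. \<Sum>w\<in>S. K x z * K z w * kernel_pow S K m w y)"
    by (simp add: sum_distrib_left mult.assoc)
  then show ?thesis
    by (subst (asm) sum.swap) (simp add: sum_distrib_right)
qed

text \<open>In terms of the projections \<open>P\<close> onto \<open>T\<close> and \<open>Q\<close> onto the complement of \<open>T\<close>, the
  two vanishing sums say that \<open>Q K P K = 0\<close> and \<open>Q K Q K = 0\<close>. The aim is to replace \<open>K\<close> by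
  its compression \<open>P K P\<close>.\<close>

locale deletable =
  fixes S T :: "'a set" and K :: "'a \<Rightarrow> 'a \<Rightarrow> 'b::comm_ring_1"
  assumes finite_S: "finite S" and sub: "T \<subseteq> S"
    and through_kept: "\<And>x z. x \<in> S - T \<Longrightarrow> z \<in> S \<Longrightarrow> (\<Sum>y\<in>T. K x y * K y z) = 0"
    and through_deleted: "\<And>x z. x \<in> S - T \<Longrightarrow> z \<in> S \<Longrightarrow> (\<Sum>y\<in>S - T. K x y * K y z) = 0"
begin

lemma finite_T: "finite T"
  using finite_S sub finite_subset by blast

lemma deleted_row_zero:
  assumes "x \<in> S - T"
  shows "kernel_pow S K (Suc (Suc m)) x y = 0"
proof -
  have "(\<Sum>z\<in>S. K x z * K z w) = 0" if "w \<in> S" for w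
    using through_kept[OF assms that] through_deleted[OF assms that]
      sum.subset_diff[OF sub finite_S, of "\<lambda>z. K x z * K z w"] by simp
  then show ?thesis
    unfolding kernel_pow_two_steps by simp
qed

text \<open>Since \<open>Q K\<^sup>2 = 0\<close>, a walk that starts in \<open>T\<close> contributes only if it stays in \<open>T\<close> until two
  steps before its end.\<close>

lemma kernel_pow_factor:
  assumes "x \<in> T"
  shows "kernel_pow S K (Suc (Suc m)) x y
    = (\<Sum>z\<in>T. kernel_pow T K m x z * kernel_pow S K (Suc (Suc 0)) z y)"
  using assms
proof (induction m arbitrary: x)
  case 0
  have "(\<Sum>z\<in>T. kernel_pow T K 0 x z * kernel_pow S K (Suc (Suc 0)) z y)
      = (\<Sum>z\<in>T. if x = z then kernel_pow S K (Suc (Suc 0)) z y else 0)"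
    by (auto intro!: sum.cong)
  then show ?case using finite_T 0 by simp
next
  case (Suc m)
  have "kernel_pow S K (Suc (Suc (Suc m))) x y = (\<Sum>w\<in>S. K x w * kernel_pow S K (Suc (Suc m)) w y)"
    by (rule fun_cong[OF fun_cong[OF kernel_pow.simps(2)]])
  also have "\<dots> = (\<Sum>w\<in>T. K x w * kernel_pow S K (Suc (Suc m)) w y)"
    using deleted_row_zero[of _ m y]
    by (intro sum.mono_neutral_right finite_S sub) (simp del: kernel_pow.simps)
  also have "\<dots> = (\<Sum>w\<in>T. \<Sum>z\<in>T. K x w * kernel_pow T K m w z * kernel_pow S K (Suc (Suc 0)) z y)"
    using Suc.IH by (simp add: sum_distrib_left mult.assoc del: kernel_pow.simps cong: sum.cong)
  also have "\<dots> = (\<Sum>z\<in>T. (\<Sum>w\<in>T. K x w * kernel_pow T K m w z) * kernel_pow S K (Suc (Suc 0)) z y)"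
    by (subst sum.swap) (simp add: sum_distrib_right del: kernel_pow.simps)
  finally show ?case by (simp only: kernel_pow.simps(2)[of T K m])
qed

text \<open>By the preceding factorization only the last intermediate vertex of a closed walk may lie outside
  \<open>T\<close>. For a closed walk the contribution of such a vertex is killed too: the two steps that leave it
  run through \<open>T\<close>, and \<open>Q K P K = 0\<close>. Three steps are needed for
  the two steps to exist besides the one that leads to that vertex.\<close>

lemma kernel_trace_restrict:
  "kernel_trace S (kernel_pow S K (m + 3)) = kernel_trace T (kernel_pow T K (m + 3))"
proof -
  let ?P = "kernel_pow T K (Suc m)"
  have "kernel_trace S (kernel_pow S K (m + 3)) = (\<Sum>x\<in>T. kernel_pow S K (m + 3) x x)"
    unfolding kernel_trace_def using deleted_row_zero[of _ "Suc m"]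
    by (intro sum.mono_neutral_right finite_S sub) (simp add: numeral_3_eq_3 del: kernel_pow.simps)
  also have "\<dots> = (\<Sum>x\<in>T. \<Sum>z\<in>T. ?P x z * (\<Sum>w\<in>S. K z w * K w x))"
  proof (rule sum.cong[OF refl])
    fix x assume x: "x \<in> T"
    have "kernel_pow S K (m + 3) x x = (\<Sum>z\<in>T. ?P x z * kernel_pow S K (Suc (Suc 0)) z x)"
      using kernel_pow_factor[OF x, of "Suc m" x] by (simp only: numeral_3_eq_3 add_Suc_right add_0_right)
    then show "kernel_pow S K (m + 3) x x = (\<Sum>z\<in>T. ?P x z * (\<Sum>w\<in>S. K z w * K w x))"
      using kernel_pow_2[OF finite_S, of x K] x sub by (simp only: subsetD)
  qed
  also have "\<dots> = (\<Sum>x\<in>T. \<Sum>z\<in>T. ?P x z * (\<Sum>w\<in>T. K z w * K w x))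
      + (\<Sum>x\<in>T. \<Sum>z\<in>T. ?P x z * (\<Sum>w\<in>S - T. K z w * K w x))"
    by (simp add: sum.subset_diff[OF sub finite_S] distrib_left sum.distrib add.commute
        del: kernel_pow.simps)
  also have "(\<Sum>x\<in>T. \<Sum>z\<in>T. ?P x z * (\<Sum>w\<in>S - T. K z w * K w x)) = 0"
  proof -
    \<comment> \<open>Because the walk is closed, the step from \<open>w\<close> to \<open>x\<close> is followed by the first step from \<open>x\<close>.\<close>
    have zero: "(\<Sum>x\<in>T. K w x * ?P x z) = 0" if "w \<in> S - T" for w z
    proof -
      have "(\<Sum>x\<in>T. K w x * ?P x z) = kernel_pow T K (Suc (Suc m)) w z"
        by (rule fun_cong[OF fun_cong[OF kernel_pow.simps(2)], symmetric])
      also have "\<dots> = 0"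
        unfolding kernel_pow_two_steps using through_kept[OF that] sub by (simp add: subset_iff)
      finally show ?thesis .
    qed
    have "(\<Sum>x\<in>T. \<Sum>z\<in>T. ?P x z * (\<Sum>w\<in>S - T. K z w * K w x))
        = (\<Sum>z\<in>T. \<Sum>x\<in>T. \<Sum>w\<in>S - T. K z w * (K w x * ?P x z))"
      by (subst sum.swap) (simp add: sum_distrib_left mult_ac del: kernel_pow.simps)
    also have "\<dots> = (\<Sum>z\<in>T. \<Sum>w\<in>S - T. \<Sum>x\<in>T. K z w * (K w x * ?P x z))"
      by (rule sum.cong[OF refl], rule sum.swap)
    also have "\<dots> = 0"
      by (simp add: sum_distrib_left[symmetric] zero del: kernel_pow.simps)
    finally show ?thesis .
  qed
  also have "(\<Sum>x\<in>T. \<Sum>z\<in>T. ?P x z * (\<Sum>w\<in>T. K z w * K w x))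
      = (\<Sum>x\<in>T. kernel_pow T K (m + 3) x x)"
  proof (rule sum.cong[OF refl])
    fix x assume x: "x \<in> T"
    show "(\<Sum>z\<in>T. ?P x z * (\<Sum>w\<in>T. K z w * K w x)) = kernel_pow T K (m + 3) x x"
      using kernel_pow_add[OF finite_T x, of K "Suc m" "Suc (Suc 0)" x] kernel_pow_2[OF finite_T x, of K]
      by (simp only: numeral_3_eq_3 add_Suc_right add_0_right add_Suc)
  qed
  finally show ?thesis by (simp add: kernel_trace_def)
qed

lemma kernel_pow_zero_lift:
  assumes "\<And>x y. x \<in> T \<Longrightarrow> y \<in> T \<Longrightarrow> kernel_pow T K m x y = 0" "x \<in> S"
  shows "kernel_pow S K (Suc (Suc m)) x y = 0"
proof (cases "x \<in> T")
  case True
  then show ?thesis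
    unfolding kernel_pow_factor[OF True] using assms(1) by (simp del: kernel_pow.simps)
next
  case False
  then show ?thesis using deleted_row_zero assms(2) by blast
qed

end

locale tensor_kernel =
  fixes A :: "'a set" and B :: "'b set" and T :: "'c set"
    and G :: "'a \<Rightarrow> 'a \<Rightarrow> 'd::comm_ring_1" and H :: "'b \<Rightarrow> 'b \<Rightarrow> 'd"
    and K :: "'c \<Rightarrow> 'c \<Rightarrow> 'd" and f :: "'a \<times> 'b \<Rightarrow> 'c"
  assumes bij: "bij_betw f (A \<times> B) T"
    and kernel_mult: "\<And>a b a' b'. a \<in> A \<Longrightarrow> b \<in> B \<Longrightarrow> a' \<in> A \<Longrightarrow> b' \<in> B \<Longrightarrow>
      K (f (a, b)) (f (a', b')) = G a a' * H b b'"
begin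

lemma kernel_pow_mult:
  assumes "a \<in> A" "b \<in> B" "a' \<in> A" "b' \<in> B"
  shows "kernel_pow T K m (f (a, b)) (f (a', b')) = kernel_pow A G m a a' * kernel_pow B H m b b'"
  using assms(1,2)
proof (induction m arbitrary: a b)
  case 0
  have "f (a, b) = f (a', b') \<longleftrightarrow> a = a' \<and> b = b'"
    using inj_on_eq_iff[OF bij_betw_imp_inj_on[OF bij]] 0 assms(3,4) by auto
  then show ?case by simp
next
  case (Suc m)
  have "kernel_pow T K (Suc m) (f (a, b)) (f (a', b'))
      = (\<Sum>p\<in>A \<times> B. K (f (a, b)) (f p) * kernel_pow T K m (f p) (f (a', b')))"
    by (simp add: sum.reindex_bij_betw[OF bij, symmetric])
  also have "\<dots> = (\<Sum>(c, d)\<in>A \<times> B. (G a c * kernel_pow A G m c a') * (H b d * kernel_pow B H m d b'))"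
    using Suc kernel_mult by (intro sum.cong) (auto simp: mult_ac)
  also have "\<dots> = kernel_pow A G (Suc m) a a' * kernel_pow B H (Suc m) b b'"
    by (simp add: sum_product sum.cartesian_product)
  finally show ?case .
qed

lemma kernel_trace_mult:
  "kernel_trace T (kernel_pow T K m)
    = kernel_trace A (kernel_pow A G m) * kernel_trace B (kernel_pow B H m)"
proof -
  have "kernel_trace T (kernel_pow T K m) = (\<Sum>p\<in>A \<times> B. kernel_pow T K m (f p) (f p))"
    unfolding kernel_trace_def by (rule sum.reindex_bij_betw[OF bij, symmetric])
  also have "\<dots> = (\<Sum>(a, b)\<in>A \<times> B. kernel_pow A G m a a * kernel_pow B H m b b)"
    by (intro sum.cong refl) (auto simp: kernel_pow_mult)
  finally show ?thesis
    by (simp add: kernel_trace_def sum_product sum.cartesian_product)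
qed

end

lemma kernel_pow_mat:
  fixes K :: "'a \<Rightarrow> 'a \<Rightarrow> 'b::comm_ring_1"
  assumes "distinct cs" "a < length cs" "b < length cs"
  defines "A \<equiv> mat (length cs) (length cs) (\<lambda>(a, b). K (cs ! a) (cs ! b))"
  shows "(A ^\<^sub>m m) $$ (a, b) = kernel_pow (set cs) K m (cs ! a) (cs ! b)"
  using assms(3)
proof (induction m arbitrary: b)
  case 0
  then show ?case using assms(1,2) by (simp add: A_def nth_eq_iff_index_eq)
next
  case (Suc m)
  have A: "A \<in> carrier_mat (length cs) (length cs)" by (simp add: A_def)
  have dims: "dim_row (A ^\<^sub>m m) = length cs" "dim_col (A ^\<^sub>m m) = length cs" using A by auto
  have bij: "bij_betw ((!) cs) {0..<length cs} (set cs)"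
    using bij_betw_nth[OF assms(1) refl refl] by (simp add: atLeast0LessThan)
  have "(A ^\<^sub>m Suc m) $$ (a, b) = (\<Sum>c = 0..<length cs. (A ^\<^sub>m m) $$ (a, c) * A $$ (c, b))"
    using A dims assms(2) Suc.prems by (simp add: scalar_prod_def)
  also have "\<dots> = (\<Sum>c = 0..<length cs. kernel_pow (set cs) K m (cs ! a) (cs ! c)
      * kernel_pow (set cs) K (Suc 0) (cs ! c) (cs ! b))"
  proof (rule sum.cong[OF refl])
    fix c assume "c \<in> {0..<length cs}"
    moreover from this have "A $$ (c, b) = K (cs ! c) (cs ! b)"
      using Suc.prems by (simp add: A_def)
    ultimately show "(A ^\<^sub>m m) $$ (a, c) * A $$ (c, b) = kernel_pow (set cs) K m (cs ! a) (cs ! c)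
        * kernel_pow (set cs) K (Suc 0) (cs ! c) (cs ! b)"
      using Suc.IH Suc.prems by (simp add: kernel_pow_1 del: kernel_pow.simps)
  qed
  also have "\<dots> = (\<Sum>z\<in>set cs. kernel_pow (set cs) K m (cs ! a) z
      * kernel_pow (set cs) K (Suc 0) z (cs ! b))"
    by (rule sum.reindex_bij_betw[OF bij])
  also have "\<dots> = kernel_pow (set cs) K (m + Suc 0) (cs ! a) (cs ! b)"
    using assms(2) by (intro kernel_pow_add[symmetric]) auto
  finally show ?case by (simp del: kernel_pow.simps)
qed

section \<open>Traces of powers determine the nonzero eigenvalues\<close>

definition mat_trace :: "'a::comm_ring_1 mat \<Rightarrow> 'a" where
  "mat_trace A = (\<Sum>a<dim_row A. A $$ (a, a))"

lemma mat_trace_mult_commute: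
  assumes "A \<in> carrier_mat n n" "B \<in> carrier_mat n n"
  shows "mat_trace (A * B) = mat_trace (B * A)"
proof -
  have "mat_trace (A * B) = (\<Sum>a<n. \<Sum>b<n. A $$ (a, b) * B $$ (b, a))"
    using assms by (simp add: mat_trace_def scalar_prod_def atLeast0LessThan)
  also have "\<dots> = (\<Sum>b<n. \<Sum>a<n. B $$ (b, a) * A $$ (a, b))"
    by (subst sum.swap) (simp add: mult.commute)
  also have "\<dots> = mat_trace (B * A)"
    using assms by (simp add: mat_trace_def scalar_prod_def atLeast0LessThan)
  finally show ?thesis .
qed

lemma mat_trace_similar:
  assumes "similar_mat A B"
  shows "mat_trace A = mat_trace B"
proof -
  obtain n P Q where c: "{A, B, P, Q} \<subseteq> carrier_mat n n" and "Q * P = 1\<^sub>m n" "A = P * B * Q"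
    using similar_matD[OF assms] by blast
  moreover have "mat_trace (P * B * Q) = mat_trace (Q * (P * B))"
    using c by (intro mat_trace_mult_commute) auto
  moreover have "Q * (P * B) = (Q * P) * B"
    using c by (auto intro!: assoc_mult_mat[symmetric])
  moreover have "1\<^sub>m n * B = B" using c by auto
  ultimately show ?thesis by simp
qed

lemma upper_triangular_pow_diag:
  fixes B :: "'a::comm_ring_1 mat"
  assumes B: "B \<in> carrier_mat n n" and tri: "upper_triangular B" and "a < n"
  shows "(\<forall>b<a. (B ^\<^sub>m m) $$ (a, b) = 0) \<and> (B ^\<^sub>m m) $$ (a, a) = B $$ (a, a) ^ m"
proof (induction m)
  case 0
  then show ?case using assms by auto
next
  case (Suc m)
  have entry: "(B ^\<^sub>m Suc m) $$ (a, b) = (\<Sum>c<n. (B ^\<^sub>m m) $$ (a, c) * B $$ (c, b))" if "b < n" for b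
  proof -
    have "dim_row (B ^\<^sub>m m) = n" "dim_col (B ^\<^sub>m m) = n" using B by auto
    then show ?thesis
      using B assms(3) that by (simp add: scalar_prod_def atLeast0LessThan)
  qed
  have zero: "B $$ (c, b) = 0" if "b < c" "c < n" for b c
    using upper_triangularD[OF tri that(1)] that(2) B by simp
  have "(B ^\<^sub>m Suc m) $$ (a, b) = 0" if "b < a" for b
    unfolding entry[OF less_trans[OF that \<open>a < n\<close>]]
  proof (rule sum.neutral, rule ballI)
    fix c assume "c \<in> {..<n}"
    then show "(B ^\<^sub>m m) $$ (a, c) * B $$ (c, b) = 0"
      using Suc zero[of b c] that by (cases "c < a") auto
  qed
  moreover have "(B ^\<^sub>m Suc m) $$ (a, a) = (\<Sum>c<n. if c = a then B $$ (a, a) ^ Suc m else 0)"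
    unfolding entry[OF \<open>a < n\<close>]
  proof (rule sum.cong[OF refl])
    fix c assume "c \<in> {..<n}"
    then show "(B ^\<^sub>m m) $$ (a, c) * B $$ (c, a) = (if c = a then B $$ (a, a) ^ Suc m else 0)"
      using Suc zero[of a c] by (cases c a rule: linorder_cases) auto
  qed
  ultimately show ?case using \<open>a < n\<close> by simp
qed

text \<open>The trace is invariant under similarity, and in Schur form the powers have the powers of the
  eigenvalues on their diagonal.\<close>

lemma mat_trace_pow_eigenvalues:
  fixes A :: "complex mat"
  assumes A: "A \<in> carrier_mat n n" and as: "char_poly A = (\<Prod>a\<leftarrow>as. [:- a, 1:])"
  shows "mat_trace (A ^\<^sub>m m) = (\<Sum>a\<leftarrow>as. a ^ m)"
proof -
  obtain B P Q where "schur_decomposition A as = (B, P, Q)"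
    by (cases "schur_decomposition A as")
  from schur_decomposition[OF A as this]
  have sim: "similar_mat_wit A B P Q" and tri: "upper_triangular B" and diag: "diag_mat B = as"
    by auto
  have B: "B \<in> carrier_mat n n" using similar_mat_witD2[OF A sim] by blast
  have "mat_trace (A ^\<^sub>m m) = mat_trace (B ^\<^sub>m m)"
    using similar_mat_wit_pow[OF sim, of m] by (intro mat_trace_similar) (auto simp: similar_mat_def)
  also have "\<dots> = (\<Sum>a<n. B $$ (a, a) ^ m)"
    using B upper_triangular_pow_diag[OF B tri] by (simp add: mat_trace_def)
  also have "\<dots> = (\<Sum>a\<leftarrow>as. a ^ m)"
    using B by (simp add: diag[symmetric] diag_mat_def o_def atLeast0LessThan
        interv_sum_list_conv_sum_set_nat)
  finally show ?thesis .
qed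

lemma sum_list_map_conv_sum_of_nat_count:
  fixes f :: "'a \<Rightarrow> 'b::comm_semiring_1"
  assumes "set xs \<subseteq> X" "finite X"
  shows "sum_list (map f xs) = (\<Sum>x\<in>X. of_nat (count_list xs x) * f x)"
  using assms(1)
proof (induction xs)
  case (Cons a xs)
  have "(\<Sum>x\<in>X. of_nat (count_list (a # xs) x) * f x)
      = (\<Sum>x\<in>X. (if x = a then f x else 0) + of_nat (count_list xs x) * f x)"
    by (intro sum.cong) (auto simp: algebra_simps)
  then show ?case using Cons assms(2) by (simp add: sum.distrib)
qed simp

lemma order_prod_linear_factors:
  "Polynomial.order x (\<Prod>a\<leftarrow>as. [:- a, 1:]) = count_list as (x :: 'a::idom)"
proof (induction as)
  case Nil
  then show ?case by (simp add: order_0I)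
next
  case (Cons a as)
  have "Polynomial.order x [:- a, 1:] = (if a = x then 1 else 0)"
    using order_linear_power'[of x a 0] by (simp add: order_0I)
  moreover have "(\<Prod>b\<leftarrow>a # as. [:- b, 1:]) \<noteq> 0"
    by (auto simp: prod_list_zero_iff simp del: mult_pCons_left)
  ultimately show ?case
    using Cons by (simp add: order_mult del: mult_pCons_left)
qed

text \<open>Vandermonde independence. By linearity the hypothesis extends from the powers \<open>x\<^sup>m\<close> to all
  polynomials, so it can be tested on a polynomial that vanishes on \<open>T\<close> except at \<open>y\<close>. The
  factor \<open>x\<^sup>k\<close>, which remains, is harmless for \<open>y \<noteq> 0\<close>.\<close>

lemma power_sums_vanish_imp_coeff_zero:
  fixes c :: "'a::idom \<Rightarrow> 'a"
  assumes T: "finite T" and sums: "\<And>m. (\<Sum>x\<in>T. c x * x ^ (m + k)) = 0"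
    and y: "y \<in> T" "y \<noteq> 0"
  shows "c y = 0"
proof -
  define p where "p = (\<Prod>x\<in>T - {y}. [:- x, 1:])"
  have "(\<Sum>x\<in>T. c x * (poly p x * x ^ k))
      = (\<Sum>x\<in>T. \<Sum>m\<le>degree p. coeff p m * (c x * x ^ (m + k)))"
    by (simp add: poly_altdef sum_distrib_left sum_distrib_right power_add mult_ac)
  also have "\<dots> = (\<Sum>m\<le>degree p. coeff p m * (\<Sum>x\<in>T. c x * x ^ (m + k)))"
    by (subst sum.swap) (simp add: sum_distrib_left)
  also have "\<dots> = 0" by (simp add: sums)
  finally have "(\<Sum>x\<in>T. c x * (poly p x * x ^ k)) = 0" .
  moreover have "(\<Sum>x\<in>T. c x * (poly p x * x ^ k))
      = (\<Sum>x\<in>{y}. c x * (poly p x * x ^ k))"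
    using T y by (intro sum.mono_neutral_right) (auto simp: p_def poly_prod)
  moreover have "poly p y \<noteq> 0"
    using T by (auto simp: p_def poly_prod)
  ultimately show ?thesis using y by simp
qed

text \<open>The difference between the true multiplicities and \<open>c\<close> satisfies the hypotheses of the preceding
  independence lemma. The multiplicity of \<open>0\<close>, which no trace can see, is what is left of
  the dimension.\<close>

lemma alg_mult_from_traces:
  fixes A :: "complex mat"
  assumes A: "A \<in> carrier_mat n n" and X: "finite X" "0 \<notin> X"
    and traces: "\<And>m. mat_trace (A ^\<^sub>m (m + k)) = (\<Sum>x\<in>X. c x * x ^ (m + k))"
  shows "x \<noteq> 0 \<Longrightarrow> of_nat (alg_mult A x) = (if x \<in> X then c x else 0)"
    and "of_nat (alg_mult A 0) = of_nat n - sum c X"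
proof -
  obtain as where as: "char_poly A = (\<Prod>a\<leftarrow>as. [:- a, 1:])" "length as = n"
    using char_poly_factorized[OF A] by blast
  have mult: "alg_mult A x = count_list as x" for x
    by (simp add: alg_mult_def as order_prod_linear_factors)
  have nonzero: "of_nat (alg_mult A x) = (if x \<in> X then c x else 0)" if "x \<noteq> 0" for x
  proof -
    let ?T = "insert x (set as \<union> X)"
    let ?e = "\<lambda>y. of_nat (count_list as y) - (if y \<in> X then c y else 0)"
    have "(\<Sum>y\<in>?T. ?e y * y ^ (m + k)) = 0" for m
    proof -
      have "(\<Sum>y\<in>?T. (if y \<in> X then c y else 0) * y ^ (m + k)) = (\<Sum>y\<in>X. c y * y ^ (m + k))"
        using X by (intro sum.mono_neutral_cong_right) auto
      moreover have "(\<Sum>y\<in>?T. of_nat (count_list as y) * y ^ (m + k)) = (\<Sum>a\<leftarrow>as. a ^ (m + k))"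
        using X by (intro sum_list_map_conv_sum_of_nat_count[symmetric]) auto
      moreover have "(\<Sum>a\<leftarrow>as. a ^ (m + k)) = (\<Sum>y\<in>X. c y * y ^ (m + k))"
        using traces[of m] mat_trace_pow_eigenvalues[OF A as(1), of "m + k"] by metis
      ultimately show ?thesis
        by (simp only: left_diff_distrib sum_subtractf diff_self)
    qed
    then have "?e x = 0"
      by (rule power_sums_vanish_imp_coeff_zero[where T = ?T and c = ?e and k = k, rotated])
        (use X that in auto)
    then show ?thesis by (simp add: mult)
  qed
  then show "x \<noteq> 0 \<Longrightarrow> of_nat (alg_mult A x) = (if x \<in> X then c x else 0)" .
  let ?T = "(set as - {0}) \<union> X"
  have "n = sum (count_list as) (insert 0 ?T)"
    using X by (subst sum_count_set) (auto simp: as)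
  also have "\<dots> = count_list as 0 + sum (count_list as) ?T"
    using X by simp
  finally have "(of_nat n :: complex) = of_nat (alg_mult A 0) + (\<Sum>y\<in>?T. of_nat (alg_mult A y))"
    by (simp add: mult)
  moreover have "(\<Sum>y\<in>?T. of_nat (alg_mult A y)) = sum c X"
  proof -
    have "(\<Sum>y\<in>?T. of_nat (alg_mult A y)) = (\<Sum>y\<in>?T. if y \<in> X then c y else 0)"
      using X by (intro sum.cong nonzero refl) auto
    also have "\<dots> = sum c X"
      using X by (intro sum.mono_neutral_cong_right) auto
    finally show ?thesis .
  qed
  ultimately show "of_nat (alg_mult A 0) = of_nat n - sum c X" by simp
qed

section \<open>Independent sets of the path\<close>

lemma finite_indep_sets: "finite (indep_sets N)"
  by (rule finite_subset[of _ "Pow {1..N}"]) (auto simp: indep_sets_def)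

lemma indep_setsD:
  assumes "C \<in> indep_sets N"
  shows "finite C" "0 \<notin> C" "k \<in> C \<Longrightarrow> Suc k \<notin> C" "k \<in> C \<Longrightarrow> k \<le> N"
  using assms finite_subset[of C "{1..N}"] by (auto simp: indep_sets_def)

text \<open>The Fibonacci recurrence: an independent set of the path on \<open>N + 2\<close> vertices either avoids the last
  vertex, or contains it and avoids the one before it.\<close>

lemma card_indep_sets: "card (indep_sets N) = F (N + 1)"
proof (induction N rule: fib.induct)
  case 1
  have "indep_sets 0 = {{}}" by (auto simp: indep_sets_def)
  then show ?case by (simp add: F_def)
next
  case 2
  have "indep_sets (Suc 0) = {{}, {1}}" by (auto simp: indep_sets_def)
  then show ?case by (simp add: F_def numeral_3_eq_3)
next
  case (3 N)
  let ?n = "Suc (Suc N)"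
  have split: "indep_sets ?n = indep_sets (Suc N) \<union> insert ?n ` indep_sets N"
  proof (intro equalityI subsetI)
    fix C assume C: "C \<in> indep_sets ?n"
    show "C \<in> indep_sets (Suc N) \<union> insert ?n ` indep_sets N"
    proof (cases "?n \<in> C")
      case False
      then show ?thesis using C by (auto simp: indep_sets_def subset_iff le_Suc_eq)
    next
      case True
      then have "Suc N \<notin> C" using indep_setsD(3)[OF C, of "Suc N"] by auto
      then have "C - {?n} \<in> indep_sets N"
        using C by (auto simp: indep_sets_def subset_iff le_Suc_eq)
      moreover have "C = insert ?n (C - {?n})" using True by auto
      ultimately show ?thesis by blast
    qed
  next
    fix C assume "C \<in> indep_sets (Suc N) \<union> insert ?n ` indep_sets N"
    then show "C \<in> indep_sets ?n" by (force simp: indep_sets_def)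
  qed
  have "?n \<notin> C" if "C \<in> indep_sets N \<or> C \<in> indep_sets (Suc N)" for C
    using that indep_setsD(4)[of C N ?n] indep_setsD(4)[of C "Suc N" ?n] by auto
  then have "indep_sets (Suc N) \<inter> insert ?n ` indep_sets N = {}"
    and "inj_on (insert ?n) (indep_sets N)"
    by (auto intro!: inj_onI dest: insert_ident[THEN iffD1, rotated 2])
  then have "card (indep_sets ?n) = card (indep_sets (Suc N)) + card (indep_sets N)"
    by (simp add: split card_Un_disjoint finite_indep_sets card_image)
  then show ?case using 3 by (simp add: F_def)
qed

section \<open>Deleting vertex 3\<close>

lemma L_entry_insert_1:
  assumes "finite y" "1 \<notin> y" "2 \<notin> x" "0 \<notin> z"
  shows "L_entry x (insert 1 y) = \<i> * L_entry x y" "L_entry (insert 1 y) z = \<i> * L_entry y z"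
proof -
  have "x \<inter> (\<lambda>d. d + 1) ` insert 1 y = {} \<longleftrightarrow> x \<inter> (\<lambda>d. d + 1) ` y = {}"
    using assms(3) by (auto simp: numeral_2_eq_2)
  then show "L_entry x (insert 1 y) = \<i> * L_entry x y"
    using assms(1,2) by (simp add: L_entry_def)
  have "insert 1 y \<inter> (\<lambda>d. d + 1) ` z = {} \<longleftrightarrow> y \<inter> (\<lambda>d. d + 1) ` z = {}"
    using assms(4) by auto
  then show "L_entry (insert 1 y) z = \<i> * L_entry y z"
    using assms(1,2) by (simp add: L_entry_def)
qed

text \<open>The sign-reversing involution is the toggling of vertex \<open>1\<close> in the middle set \<open>y\<close>. The
  predicate \<open>Q\<close> selects the middle sets with vertex \<open>3\<close>, or those without it; both cases are needed
  to delete the vertex.\<close>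

lemma toggle_cancel:
  assumes x: "x \<in> indep_sets N" "3 \<in> x" and z: "z \<in> indep_sets N" and "N \<ge> 3"
  shows "(\<Sum>y | y \<in> indep_sets N \<and> Q (3 \<in> y). L_entry x y * L_entry y z) = 0"
proof -
  let ?U = "{y \<in> indep_sets N. Q (3 \<in> y)}"
  let ?V = "{y \<in> ?U. 2 \<notin> y}"
  let ?g = "\<lambda>y. L_entry x y * L_entry y z"
  let ?t = "\<lambda>y. if 1 \<in> y then y - {1} else insert 1 y"
  have "2 \<notin> x"
    using indep_setsD(3)[OF x(1), of 2] x(2) by auto
  have neg: "?g (insert 1 y) = - ?g y" if "y \<in> indep_sets N" "1 \<notin> y" for y
  proof -
    have "?g (insert 1 y) = (\<i> * L_entry x y) * (\<i> * L_entry y z)"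
      using L_entry_insert_1[OF indep_setsD(1)[OF that(1)] that(2) \<open>2 \<notin> x\<close> indep_setsD(2)[OF z]] by simp
    also have "\<dots> = (\<i> * \<i>) * ?g y" by (simp only: mult_ac)
    finally show ?thesis by simp
  qed
  have mem: "?t y \<in> ?V" if "y \<in> ?V" for y
  proof -
    have "Suc k \<noteq> 1 \<or> k \<notin> y" "k \<in> y \<longrightarrow> k \<noteq> 0" for k
      using that indep_setsD(2)[of y N] by (cases k; auto)+
    moreover have "1 \<in> {1..N}" using \<open>N \<ge> 3\<close> by simp
    ultimately have "?t y \<in> indep_sets N"
      using that by (auto simp: indep_sets_def numeral_2_eq_2)
    then show ?thesis using that by auto
  qed
  have anti: "?g (?t y) = - ?g y" if "y \<in> ?V" for y
  proof (cases "1 \<in> y")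
    case True
    then have "y - {1} \<in> indep_sets N" using mem[OF that] by simp
    from neg[OF this] show ?thesis using True by (simp add: insert_absorb)
  next
    case False
    then show ?thesis using neg that by auto
  qed
  \<comment> \<open>The entry at \<open>(x, y)\<close> vanishes if \<open>2 \<in> y\<close>, because \<open>3 \<in> x\<close>.\<close>
  have "sum ?g ?U = sum ?g ?V"
  proof (rule sum.mono_neutral_right)
    have "x \<inter> (\<lambda>d. d + 1) ` y \<noteq> {}" if "2 \<in> y" for y
      using that x(2) by (auto intro!: exI[of _ 3] image_eqI[of _ _ 2] simp: set_eq_iff)
    then show "\<forall>y\<in>?U - ?V. ?g y = 0" by (auto simp: L_entry_def)
  qed (auto simp: finite_indep_sets)
  moreover have "sum ?g ?V = (\<Sum>y\<in>?V. - ?g y)"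
    using mem anti by (intro sum.reindex_bij_witness[of _ ?t ?t]) (auto simp: insert_absorb)
  then have "sum ?g ?V = - sum ?g ?V" by (simp add: sum_negf)
  then have "sum ?g ?V = 0" by simp
  ultimately show ?thesis by simp
qed

lemma deletable_column_3:
  assumes "N \<ge> 3"
  shows "deletable (indep_sets N) {C \<in> indep_sets N. 3 \<notin> C} L_entry"
proof
  fix x z assume x: "x \<in> indep_sets N - {C \<in> indep_sets N. 3 \<notin> C}" and z: "z \<in> indep_sets N"
  show "(\<Sum>y | y \<in> indep_sets N \<and> 3 \<notin> y. L_entry x y * L_entry y z) = 0"
    using toggle_cancel[of x N z Not] x z assms by auto
  have "indep_sets N - {C \<in> indep_sets N. 3 \<notin> C} = {C \<in> indep_sets N. 3 \<in> C}" by auto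
  then show "(\<Sum>y\<in>indep_sets N - {C \<in> indep_sets N. 3 \<notin> C}. L_entry x y * L_entry y z) = 0"
    using toggle_cancel[of x N z "\<lambda>b. b"] x z assms by auto
qed (auto simp: finite_indep_sets)

section \<open>Splitting off the vertices 1 and 2\<close>

text \<open>An independent set without \<open>3\<close> is encoded by its part in \<open>{1, 2}\<close> and its part above \<open>3\<close>. The
  latter is shifted down, so that it is itself an independent set of a shorter path.\<close>

definition join3 :: "nat set \<times> nat set \<Rightarrow> nat set" where
  "join3 = (\<lambda>(C, D). C \<union> (\<lambda>d. d + 3) ` D)"

lemma bij_betw_join3:
  "bij_betw join3 (indep_sets 2 \<times> indep_sets M) {C \<in> indep_sets (M + 3). 3 \<notin> C}"
proof (rule bij_betw_byWitness[of _ "\<lambda>E. (E \<inter> {1, 2}, {d. d + 3 \<in> E})"])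
  show "\<forall>p\<in>indep_sets 2 \<times> indep_sets M. (join3 p \<inter> {1, 2}, {d. d + 3 \<in> join3 p}) = p"
    by (fastforce simp: join3_def indep_sets_def)
  show "\<forall>E\<in>{C \<in> indep_sets (M + 3). 3 \<notin> C}. join3 (E \<inter> {1, 2}, {d. d + 3 \<in> E}) = E"
  proof
    fix E assume E: "E \<in> {C \<in> indep_sets (M + 3). 3 \<notin> C}"
    have "e \<in> {1, 2} \<or> e \<in> (\<lambda>d. d + 3) ` {d. d + 3 \<in> E}" if "e \<in> E" for e
    proof (cases "e \<ge> 3")
      case True
      then show ?thesis using that by (auto intro!: image_eqI[of _ _ "e - 3"])
    next
      case False
      moreover have "e \<noteq> 0" using E that indep_setsD(2)[of E "M + 3"] by (cases e) auto
      ultimately show ?thesis by auto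
    qed
    then show "join3 (E \<inter> {1, 2}, {d. d + 3 \<in> E}) = E"
      by (auto simp: join3_def)
  qed
  show "join3 ` (indep_sets 2 \<times> indep_sets M) \<subseteq> {C \<in> indep_sets (M + 3). 3 \<notin> C}"
    by (fastforce simp: join3_def indep_sets_def)
  show "(\<lambda>E. (E \<inter> {1, 2}, {d. d + 3 \<in> E})) ` {C \<in> indep_sets (M + 3). 3 \<notin> C}
      \<subseteq> indep_sets 2 \<times> indep_sets M"
  proof clarify
    fix E assume E: "E \<in> indep_sets (M + 3)" "3 \<notin> E"
    have "d \<noteq> 0" if "d + 3 \<in> E" for d using that E(2) by (cases d) auto
    then show "E \<inter> {1, 2} \<in> indep_sets 2 \<and> {d. d + 3 \<in> E} \<in> indep_sets M"
      using E by (auto simp: indep_sets_def subset_iff Suc_le_eq)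
  qed
qed

text \<open>The shifted copy of \<open>D\<close> lies above \<open>3\<close>, which \<open>C' + 1\<close> does not exceed, and \<open>C\<close> lies below the
  shifted copy of \<open>D' + 1\<close>: the two parts do not see
  each other, neither in the compatibility condition nor in the weight.\<close>

lemma L_entry_join3:
  assumes "C \<in> indep_sets 2" "D \<in> indep_sets M" "C' \<in> indep_sets 2" "D' \<in> indep_sets M"
  shows "L_entry (join3 (C, D)) (join3 (C', D')) = L_entry C C' * L_entry D D'"
proof -
  have card: "card (join3 (A, B)) = card A + card B"
    if "A \<in> indep_sets 2" "B \<in> indep_sets M" for A B
  proof -
    have "A \<inter> (\<lambda>d. d + 3) ` B = {}"
      using indep_setsD(4)[OF that(1)] by force
    then show ?thesis
      using indep_setsD(1)[OF that(1)] indep_setsD(1)[OF that(2)]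
      by (simp add: join3_def card_Un_disjoint card_image)
  qed
  have "C \<inter> (\<lambda>d. d + 1) ` (\<lambda>d. d + 3) ` D' = {}"
    using indep_setsD(4)[OF assms(1)] by force
  moreover have "(\<lambda>d. d + 3) ` D \<inter> (\<lambda>d. d + 1) ` C' = {}"
    using indep_setsD(4)[OF assms(3)] indep_setsD(2)[OF assms(2)] by (force simp: gr0_conv_Suc)
  moreover have "(\<lambda>d. d + 3) ` D \<inter> (\<lambda>d. d + 1) ` (\<lambda>d. d + 3) ` D' = {} \<longleftrightarrow> D \<inter> (\<lambda>d. d + 1) ` D' = {}"
    by auto
  ultimately have "join3 (C, D) \<inter> (\<lambda>d. d + 1) ` join3 (C', D') = {}
      \<longleftrightarrow> C \<inter> (\<lambda>d. d + 1) ` C' = {} \<and> D \<inter> (\<lambda>d. d + 1) ` D' = {}"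
    unfolding join3_def by auto
  then show ?thesis
    using assms by (simp add: L_entry_def card power_add mult_ac)
qed

lemma tensor_kernel_join3:
  "tensor_kernel (indep_sets 2) (indep_sets M) {C \<in> indep_sets (M + 3). 3 \<notin> C}
    L_entry L_entry L_entry join3"
  by (unfold_locales, rule bij_betw_join3, rule L_entry_join3)

section \<open>The traces of the powers of the transfer matrix\<close>

definition L_trace :: "nat \<Rightarrow> nat \<Rightarrow> complex" where
  "L_trace N m = kernel_trace (indep_sets N) (kernel_pow (indep_sets N) L_entry m)"

lemma L_trace_step: "L_trace (N + 3) (m + 3) = L_trace 2 (m + 3) * L_trace N (m + 3)"
proof -
  interpret deletable "indep_sets (N + 3)" "{C \<in> indep_sets (N + 3). 3 \<notin> C}" L_entry
    by (rule deletable_column_3) simp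
  show ?thesis
    unfolding L_trace_def kernel_trace_restrict
    by (rule tensor_kernel.kernel_trace_mult[OF tensor_kernel_join3])
qed

lemma indep_sets_0: "indep_sets 0 = {{}}"
  by (auto simp: indep_sets_def)

lemma indep_sets_1: "indep_sets 1 = {{}, {1}}"
  by (auto simp: indep_sets_def)

lemma indep_sets_2: "indep_sets 2 = {{}, {1}, {2}}"
proof -
  have "C \<in> Pow {1, 2}" if "C \<in> indep_sets 2" for C
    using that by (auto simp: indep_sets_def subset_iff)
  moreover have "{1, 2} \<notin> indep_sets 2"
    by (auto simp: indep_sets_def intro!: exI[of _ 1])
  ultimately have "indep_sets 2 \<subseteq> Pow {1, 2} - {{1, 2}}"
    by blast
  also have "\<dots> \<subseteq> {{}, {1}, {2}}"
    by (auto simp: Pow_insert)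
  finally have "indep_sets 2 \<subseteq> {{}, {1}, {2}}" .
  then show ?thesis by (auto simp: indep_sets_def)
qed

lemma L_trace_0: "L_trace 0 m = 1"
proof -
  have "kernel_pow {{}} L_entry m {} {} = 1"
    by (induction m) (simp_all add: L_entry_def)
  then show ?thesis by (simp add: L_trace_def kernel_trace_def indep_sets_0)
qed

lemma kernel_pow_indep_sets_1: "kernel_pow (indep_sets 1) L_entry 2 x y = 0" if "x \<in> indep_sets 1" "y \<in> indep_sets 1"
  using that unfolding indep_sets_1 by (auto simp: numeral_2_eq_2 L_entry_def)

text \<open>Nilpotency passes from \<open>N - 3\<close> to the tensor product, and from there to \<open>N\<close> at the cost of two
  further powers. The induction starts at \<open>N = 1\<close>.\<close>

lemma nilpotent_kernel:
  "N mod 3 = 1 \<Longrightarrow> \<exists>m. \<forall>x\<in>indep_sets N. \<forall>y\<in>indep_sets N. kernel_pow (indep_sets N) L_entry m x y = 0"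
proof (induction N rule: less_induct)
  case (less N)
  show ?case
  proof (cases "N < 3")
    case True
    then have "N = 1" using less.prems by (cases "N = 0"; cases "N = 2") auto
    then show ?thesis using kernel_pow_indep_sets_1 by blast
  next
    case False
    then obtain M where M: "N = M + 3" by (metis add.commute le_Suc_ex not_less)
    then obtain m where m: "\<forall>x\<in>indep_sets M. \<forall>y\<in>indep_sets M. kernel_pow (indep_sets M) L_entry m x y = 0"
      using less.IH[of M] less.prems by auto
    interpret deletable "indep_sets N" "{C \<in> indep_sets N. 3 \<notin> C}" L_entry
      by (rule deletable_column_3) (simp add: M)
    have "kernel_pow {C \<in> indep_sets N. 3 \<notin> C} L_entry m x y = 0"
      if "x \<in> {C \<in> indep_sets N. 3 \<notin> C}" "y \<in> {C \<in> indep_sets N. 3 \<notin> C}" for x y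
    proof -
      have "{C \<in> indep_sets N. 3 \<notin> C} = join3 ` (indep_sets 2 \<times> indep_sets M)"
        using bij_betw_imp_surj_on[OF bij_betw_join3[of M]] by (simp add: M)
      then obtain C D C' D' where "x = join3 (C, D)" "y = join3 (C', D')"
        "C \<in> indep_sets 2" "D \<in> indep_sets M" "C' \<in> indep_sets 2" "D' \<in> indep_sets M"
        using \<open>x \<in> _\<close> \<open>y \<in> _\<close> by (smt (verit) imageE mem_Sigma_iff prod.exhaust)
      then show ?thesis
        using tensor_kernel.kernel_pow_mult[OF tensor_kernel_join3] m by (simp add: M)
    qed
    then show ?thesis using kernel_pow_zero_lift by blast
  qed
qed

text \<open>The 3 by 3 kernel has the characteristic polynomial \<open>X (X\<^sup>2 + X + 1)\<close>; this is the recurrence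
  that Cayley-Hamilton gives for its powers. It starts at exponent \<open>1\<close> because of the factor \<open>X\<close>.\<close>

lemma kernel_pow_indep_sets_2_recurrence:
  assumes "x \<in> indep_sets 2" "y \<in> indep_sets 2"
  shows "kernel_pow (indep_sets 2) L_entry (m + 3) x y = - kernel_pow (indep_sets 2) L_entry (m + 2) x y
    - kernel_pow (indep_sets 2) L_entry (m + 1) x y"
  using assms(1)
proof (induction m arbitrary: x)
  case 0
  then show ?case
    using assms(2) unfolding indep_sets_2
    by (auto simp: eval_nat_numeral L_entry_def)
next
  case (Suc m)
  have "kernel_pow (indep_sets 2) L_entry (Suc m + 3) x y
      = (\<Sum>z\<in>indep_sets 2. L_entry x z * kernel_pow (indep_sets 2) L_entry (m + 3) z y)"
    by (simp only: add_Suc kernel_pow.simps)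
  also have "\<dots> = (\<Sum>z\<in>indep_sets 2. L_entry x z * (- kernel_pow (indep_sets 2) L_entry (m + 2) z y
    - kernel_pow (indep_sets 2) L_entry (m + 1) z y))"
    by (rule sum.cong[OF refl]) (simp only: Suc.IH)
  also have "\<dots> = - kernel_pow (indep_sets 2) L_entry (Suc m + 2) x y
    - kernel_pow (indep_sets 2) L_entry (Suc m + 1) x y"
    by (simp add: right_diff_distrib sum_subtractf sum_negf)
  finally show ?case .
qed

lemma L_trace_2:
  fixes j :: complex
  assumes j: "j\<^sup>2 + j + 1 = 0"
  shows "L_trace 2 (m + 1) = j ^ (m + 1) + (j\<^sup>2) ^ (m + 1)"
proof -
  have "(j\<^sup>2)\<^sup>2 + j\<^sup>2 + 1 = (j\<^sup>2 + j + 1) * (j\<^sup>2 - j + 1)"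
    by (simp add: algebra_simps power2_eq_square)
  then have j2: "(j\<^sup>2)\<^sup>2 + j\<^sup>2 + 1 = 0"
    by (simp only: j mult_zero_left)
  have rec: "u ^ (m + 3) = - (u ^ (m + 2)) - u ^ (m + 1)" if "u\<^sup>2 + u + 1 = 0" for u :: complex and m
  proof -
    have "u ^ (m + 3) + u ^ (m + 2) + u ^ (m + 1) = u ^ (m + 1) * (u\<^sup>2 + u + 1)"
      by (simp add: power_add algebra_simps power2_eq_square power3_eq_cube)
    also have "\<dots> = 0" by (simp only: that mult_zero_right)
    finally show ?thesis by (simp only: eq_diff_eq eq_neg_iff_add_eq_0 ac_simps)
  qed
  show ?thesis
  proof (induction m rule: fib.induct)
    case 1
    have "L_trace 2 1 = - 1"
      unfolding L_trace_def kernel_trace_def indep_sets_2 by (simp add: L_entry_def)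
    moreover have "j + j\<^sup>2 = - 1"
      using j by (simp only: eq_neg_iff_add_eq_0 add.commute)
    ultimately show ?case by simp
  next
    case 2
    have "L_trace 2 2 = - 1"
      unfolding L_trace_def kernel_trace_def indep_sets_2 by (simp add: L_entry_def numeral_2_eq_2)
    moreover have "j ^ 2 + (j\<^sup>2) ^ 2 = - 1"
      using j2 by (simp only: eq_neg_iff_add_eq_0 add.commute)
    ultimately show ?case by (simp add: numeral_2_eq_2)
  next
    case (3 m)
    have "L_trace 2 (m + 3) = - L_trace 2 (m + 2) - L_trace 2 (m + 1)"
      unfolding L_trace_def kernel_trace_def
      by (simp add: kernel_pow_indep_sets_2_recurrence sum_subtractf sum_negf del: kernel_pow.simps cong: sum.cong)
    then have "L_trace 2 (m + 3) = - (j ^ (m + 2) + (j\<^sup>2) ^ (m + 2)) - (j ^ (m + 1) + (j\<^sup>2) ^ (m + 1))"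
      using 3 by simp
    also have "\<dots> = j ^ (m + 3) + (j\<^sup>2) ^ (m + 3)"
      unfolding rec[OF j, of m] rec[OF j2, of m] by simp
    finally show ?case by (simp add: numeral_3_eq_3)
  qed
qed

lemma L_trace_pow:
  fixes j :: complex
  assumes "j\<^sup>2 + j + 1 = 0"
  shows "N mod 3 \<noteq> 1 \<Longrightarrow> L_trace N (m + 3) = (j ^ (m + 3) + (j\<^sup>2) ^ (m + 3)) ^ ((N + 2) div 3)"
proof (induction N rule: less_induct)
  case (less N)
  have two: "L_trace 2 (m + 3) = j ^ (m + 3) + (j\<^sup>2) ^ (m + 3)"
    using L_trace_2[OF assms, of "m + 2"] by (simp add: numeral_3_eq_3)
  show ?case
  proof (cases "N < 3")
    case True
    then consider "N = 0" | "N = 2" using less.prems by force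
    then show ?thesis using two by cases (simp_all add: L_trace_0)
  next
    case False
    then obtain M where M: "N = M + 3" by (metis add.commute le_Suc_ex not_less)
    then show ?thesis
      using less.IH[of M] less.prems two L_trace_step[of M m] div_add_self2[of 3 "M + 2"]
      by (simp add: ac_simps)
  qed
qed

text \<open>Both sides depend only on whether \<open>w = 1\<close>, where \<open>w + w\<^sup>2 = 2\<close>, or \<open>w\<close> is a primitive cube
  root of unity, where \<open>w + w\<^sup>2 = -1\<close>. The coefficients on the right solve the resulting system of two
  linear equations.\<close>

lemma cube_root_power_sum:
  fixes w :: complex
  assumes "w ^ 3 = 1"
  shows "(w + w\<^sup>2) ^ n = (2 ^ n + 2 * (- 1) ^ n) / 3 + (2 ^ n - (- 1) ^ n) / 3 * w
    + (2 ^ n - (- 1) ^ n) / 3 * w\<^sup>2"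
proof -
  have "(w - 1) * (w\<^sup>2 + w + 1) = w ^ 3 - 1"
    by (simp add: algebra_simps power2_eq_square power3_eq_cube)
  then have "(w - 1) * (w\<^sup>2 + w + 1) = 0" by (simp only: assms diff_self)
  then consider "w = 1" | "w\<^sup>2 + w + 1 = 0"
    by (auto simp only: mult_eq_0_iff right_minus_eq)
  then show ?thesis
  proof cases
    case 1
    then show ?thesis by (simp add: field_simps)
  next
    case 2
    have sum: "w + w\<^sup>2 = - 1"
      using 2 by (simp only: eq_neg_iff_add_eq_0 add.commute)
    have multiple: "b * w + b * w\<^sup>2 = - b" for b
      unfolding distrib_left[symmetric] sum by simp
    show ?thesis
      unfolding sum add.assoc multiple by (simp add: field_simps)
  qed
qed


section \<open>The spectrum of the transfer matrix\<close>

lemma L_mat_carrier: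
  assumes "enumerates cs (indep_sets N)"
  shows "L_mat cs \<in> carrier_mat (F (N + 1)) (F (N + 1))"
  using assms card_indep_sets[of N] distinct_card[of cs]
  by (auto simp: L_mat_def enumerates_def)

lemma dim_row_L_mat: "dim_row (L_mat cs) = length cs"
  by (simp add: L_mat_def)

lemma L_mat_pow_entry:
  assumes "enumerates cs (indep_sets N)" "a < length cs" "b < length cs"
  shows "(L_mat cs ^\<^sub>m m) $$ (a, b) = kernel_pow (indep_sets N) L_entry m (cs ! a) (cs ! b)"
  using kernel_pow_mat[of cs a b L_entry m] assms by (auto simp: L_mat_def enumerates_def)

lemma mat_trace_L_mat_pow:
  assumes "enumerates cs (indep_sets N)"
  shows "mat_trace (L_mat cs ^\<^sub>m m) = L_trace N m"
proof -
  have "bij_betw ((!) cs) {..<length cs} (indep_sets N)"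
    using assms by (intro bij_betw_nth) (auto simp: enumerates_def)
  then have "L_trace N m = (\<Sum>a<length cs. kernel_pow (indep_sets N) L_entry m (cs ! a) (cs ! a))"
    unfolding L_trace_def kernel_trace_def by (rule sum.reindex_bij_betw[symmetric])
  also have "\<dots> = mat_trace (L_mat cs ^\<^sub>m m)"
    unfolding mat_trace_def
    by (intro sum.cong) (simp_all add: L_mat_pow_entry[OF assms] dim_row_L_mat)
  finally show ?thesis ..
qed

lemma nilpotent_L_mat:
  assumes "enumerates cs (indep_sets N)" "N mod 3 = 1"
  shows "nilpotent_mat (L_mat cs)"
proof -
  obtain m where m: "\<forall>x\<in>indep_sets N. \<forall>y\<in>indep_sets N. kernel_pow (indep_sets N) L_entry m x y = 0"
    using nilpotent_kernel[OF assms(2)] by blast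
  have "cs ! a \<in> indep_sets N" if "a < length cs" for a
    using nth_mem[OF that] assms(1) by (simp only: enumerates_def)
  then have "L_mat cs ^\<^sub>m m = 0\<^sub>m (dim_row (L_mat cs)) (dim_col (L_mat cs))"
    using m L_mat_carrier[OF assms(1)]
    by (intro eq_matI) (auto simp: L_mat_pow_entry[OF assms(1)] dim_row_L_mat)
  then show ?thesis
    unfolding nilpotent_mat_def by blast
qed

lemma ceiling_third: "nat \<lceil>real N / 3\<rceil> = (N + 2) div 3"
proof -
  have "\<lceil>real N / 3\<rceil> = - (- int N div 3)"
    using ceiling_divide_eq_div[of "int N" 3, where ?'a = real] by simp
  then show ?thesis by linarith
qed

theorem theorem11:
  fixes N n :: nat and j :: complex and cs :: "nat set list"
  assumes "N \<ge> 1"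
    and "n = nat \<lceil>real N / 3\<rceil>"
    and "j = exp (2 * \<i> * of_real pi / 3)"
    and "enumerates cs (indep_sets N)"
  shows "L_mat cs \<in> carrier_mat (F (N + 1)) (F (N + 1)) \<and>
    (N mod 3 = 1 \<longrightarrow> nilpotent_mat (L_mat cs)) \<and>
    (N mod 3 \<noteq> 1 \<longrightarrow>
      (\<forall>x. eigenvalue (L_mat cs) x \<longrightarrow> x \<in> {0, 1, j, j\<^sup>2}) \<and>
      real (alg_mult (L_mat cs) 0) = real (F (N + 1)) - 2 ^ n \<and>
      real (alg_mult (L_mat cs) 1) = (2 ^ n + 2 * (-1) ^ n) / 3 \<and>
      real (alg_mult (L_mat cs) j) = (2 ^ n - (-1) ^ n) / 3 \<and>
      real (alg_mult (L_mat cs) (j\<^sup>2)) = (2 ^ n - (-1) ^ n) / 3)"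
proof (intro conjI impI)
  let ?A = "L_mat cs"
  show A: "?A \<in> carrier_mat (F (N + 1)) (F (N + 1))"
    by (rule L_mat_carrier[OF assms(4)])
  show "nilpotent_mat ?A" if "N mod 3 = 1"
    by (rule nilpotent_L_mat[OF assms(4) that])
  assume N: "N mod 3 \<noteq> 1"
  have "j ^ 3 = exp (2 * of_real pi * \<i>)"
    using exp_of_nat_mult[of 3 "2 * \<i> * of_real pi / 3"] by (simp add: assms(3) ac_simps)
  then have j3: "j ^ 3 = 1"
    by (simp only: exp_two_pi_i)
  have "Re j = cos (2 * pi / 3)"
    by (simp add: assms(3) Re_exp)
  then have j1: "j \<noteq> 1"
    by (auto simp: cos_120)
  have "(j - 1) * (j\<^sup>2 + j + 1) = j ^ 3 - 1"
    by (simp add: algebra_simps power2_eq_square power3_eq_cube)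
  then have j: "j\<^sup>2 + j + 1 = 0"
    unfolding j3 diff_self using j1 by (simp only: mult_eq_0_iff right_minus_eq simp_thms)
  have distinct: "j \<noteq> 0" "j\<^sup>2 \<noteq> 1" "j \<noteq> j\<^sup>2"
    using j3 j1 by (auto simp: power3_eq_cube power2_eq_square)
  have n: "n = (N + 2) div 3" by (simp add: assms(2) ceiling_third)
  define p q :: real where "p = (2 ^ n + 2 * (- 1) ^ n) / 3" and "q = (2 ^ n - (- 1) ^ n) / 3"
  define c :: "complex \<Rightarrow> real" where "c x = (if x = 1 then p else q)" for x
  have traces: "mat_trace (?A ^\<^sub>m (m + 3)) = (\<Sum>x\<in>{1, j, j\<^sup>2}. of_real (c x) * x ^ (m + 3))" for m
  proof -
    let ?w = "j ^ (m + 3)"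
    have w2: "(j\<^sup>2) ^ (m + 3) = ?w\<^sup>2"
      by (simp only: power_mult[symmetric] mult.commute)
    have "?w ^ 3 = (j ^ 3) ^ (m + 3)"
      by (simp only: power_mult[symmetric] mult.commute)
    then have "(?w + ?w\<^sup>2) ^ n = of_real p + of_real q * ?w + of_real q * ?w\<^sup>2"
      using cube_root_power_sum[of ?w n] by (simp add: j3 p_def q_def)
    then show ?thesis
      using mat_trace_L_mat_pow[OF assms(4)] L_trace_pow[OF j N, of m] distinct j1
      by (simp add: w2 n c_def)
  qed
  have X: "finite {1, j, j\<^sup>2}" "0 \<notin> {1, j, j\<^sup>2}" using distinct by auto
  have mult: "real (alg_mult ?A x) = (if x \<in> {1, j, j\<^sup>2} then c x else 0)" if "x \<noteq> 0" for x
    using alg_mult_from_traces(1)[OF A X traces that]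
    by (metis of_real_0 of_real_eq_iff of_real_of_nat_eq)
  show "real (alg_mult ?A 1) = (2 ^ n + 2 * (-1) ^ n) / 3"
    and "real (alg_mult ?A j) = (2 ^ n - (-1) ^ n) / 3"
    and "real (alg_mult ?A (j\<^sup>2)) = (2 ^ n - (-1) ^ n) / 3"
    using mult distinct j1 by (simp_all add: c_def p_def q_def)
  have "complex_of_real (real (alg_mult ?A 0)) = of_real (real (F (N + 1)) - (p + 2 * q))"
    using alg_mult_from_traces(2)[OF A X traces] distinct j1 by (simp add: c_def)
  then have "real (alg_mult ?A 0) = real (F (N + 1)) - (p + 2 * q)"
    by (simp only: of_real_eq_iff)
  also have "p + 2 * q = 2 ^ n"
    by (simp add: p_def q_def field_simps)
  finally show "real (alg_mult ?A 0) = real (F (N + 1)) - 2 ^ n" .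
  show "\<forall>x. eigenvalue ?A x \<longrightarrow> x \<in> {0, 1, j, j\<^sup>2}"
  proof (intro allI impI)
    fix x assume "eigenvalue ?A x"
    then have "poly (char_poly ?A) x = 0"
      using eigenvalue_root_char_poly[OF A] by blast
    moreover have "char_poly ?A \<noteq> 0"
      using degree_monic_char_poly[OF A] by auto
    ultimately have "alg_mult ?A x \<noteq> 0"
      by (simp add: alg_mult_def order_root)
    then show "x \<in> {0, 1, j, j\<^sup>2}"
      using mult[of x] by (auto split: if_splits)
  qed
qed

end
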